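(* Let $a,c>0$ and $b\in\mathbb R$ with $4ac-b^2>0$, let $R=R(x,y)=\sqrt{ax^2+bxy+cy^2}$, and let $p\le -3$ be an odd integer. For $q\in\{0,1\}$ let $I^{(1)}_{p,q}=\int R^{p}x^q\,dx$ denote an antiderivative in $x$ (with $y\ne0$ fixed). Then $$I^{(1)}_{p,0}=\sum_{\ell=p+2,p+4,\dots,-1}\Bigl(\prod_{\ell_2=p,p+2,\dots,\ell-4}D_{\ell_2}\Bigr)\Bigl(\prod_{\ell_2=p,p+2,\dots,\ell-2}E_{\ell_2}\Bigr)R^{\ell}\,(2ax+by)\,y^{p-\ell},$$ where $$D_\ell=-a(2\ell+6),\qquad E_\ell=-\frac{2}{(4ac-b^2)(\ell+2)},$$ and $$I^{(1)}_{p,1}=\frac{1}{a(p+2)}R^{p+2}-\frac{b}{2a}\,y\,I^{(1)}_{p,0}.$$ That is, for $y\neq 0$ the partial derivatives with respect to $x$ of the two right-hand sides (the second one with $I^{(1)}_{p,0}$ given by the first formula) equal $R^p$ and $R^p x$, respectively.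
   Context: Sums and products run over indices in steps of $2$; an empty product (e.g. the product of the $D_{\ell_2}$ when $\ell=p+2$) equals $1$. Equalities between indefinite integrals are understood up to an additive function independent of the integration variable $x$. *)

theory Defs
  imports Complex_Main
begin

definition R :: "real \<Rightarrow> real \<Rightarrow> real \<Rightarrow> real \<Rightarrow> real \<Rightarrow> real" where
  "R a b c x y = sqrt (a * x\<^sup>2 + b * x * y + c * y\<^sup>2)"

text \<open>The indices m, m + 2, m + 4, and so on, not exceeding n; empty if n < m.\<close>
definition step2 :: "int \<Rightarrow> int \<Rightarrow> int set" where
  "step2 m n = {k \<in> {m..n}. even (k - m)}"

definition D :: "real \<Rightarrow> int \<Rightarrow> real" where
  "D a l = - a * (2 * of_int l + 6)"

definition E :: "real \<Rightarrow> real \<Rightarrow> real \<Rightarrow> int \<Rightarrow> real" where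
  "E a b c l = - (2 / ((4 * a * c - b\<^sup>2) * (of_int l + 2)))"

definition I1_0 :: "real \<Rightarrow> real \<Rightarrow> real \<Rightarrow> int \<Rightarrow> real \<Rightarrow> real \<Rightarrow> real" where
  "I1_0 a b c p x y =
     (\<Sum>l \<in> step2 (p + 2) (-1).
        (\<Prod>l2 \<in> step2 p (l - 4). D a l2) * (\<Prod>l2 \<in> step2 p (l - 2). E a b c l2) *
        R a b c x y powi l * (2 * a * x + b * y) * y powi (p - l))"

definition I1_1 :: "real \<Rightarrow> real \<Rightarrow> real \<Rightarrow> int \<Rightarrow> real \<Rightarrow> real \<Rightarrow> real" where
  "I1_1 a b c p x y =
     1 / (a * (of_int p + 2)) * R a b c x y powi (p + 2) - b / (2 * a) * y * I1_0 a b c p x y"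

end

theory Submission
  imports Defs
begin

text \<open>
  Write \<open>L = 2 a x + b y\<close> for the \<open>x\<close>-derivative of \<open>R\<^sup>2\<close>. Completing the square gives
  \<open>L\<^sup>2 = 4 a R\<^sup>2 - (4 a c - b\<^sup>2) y\<^sup>2\<close>, so in the derivative of \<open>R\<^bsup>p+2\<^esup> L\<close> the variable \<open>x\<close> can be
  eliminated in favour of \<open>R\<close>: it is a linear combination of \<open>R\<^bsup>p+2\<^esup>\<close> and \<open>R\<^sup>p y\<^sup>2\<close>. Solved for
  \<open>R\<^sup>p\<close>, it is a reduction formula
  \<open>I\<^sub>p = E\<^sub>p y\<^bsup>-2\<^esup> (R\<^bsup>p+2\<^esup> L + D\<^sub>p I\<^bsub>p+2\<^esub>)\<close>
  for the antiderivative \<open>I\<^sub>p\<close> of \<open>R\<^sup>p\<close> (lemma \<open>R_powi_reduction\<close>). The claimed closed form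
  satisfies this very recursion (lemma \<open>I1_0_rec\<close>), and the recursion stops at \<open>p = -3\<close> because
  \<open>D\<close> vanishes there; so the first formula follows by induction. The second one comes from
  \<open>x = (L - b y) / (2 a)\<close>, where \<open>R\<^sup>p L\<close> is, up to a constant, the derivative of \<open>R\<^bsup>p+2\<^esup>\<close>.
\<close>

lemma step2_empty: "n < m \<Longrightarrow> step2 m n = {}"
  by (auto simp: step2_def)

lemma finite_step2 [simp]: "finite (step2 m n)"
  by (rule finite_subset[of _ "{m..n}"]) (auto simp: step2_def)

lemma step2_rec: "m \<le> n \<Longrightarrow> step2 m n = insert m (step2 (m + 2) n)"
proof -
  have "k = m \<or> m + 2 \<le> k" if "m \<le> k" "even (k - m)" for k
    using that by presburger
  thus "m \<le> n \<Longrightarrow> step2 m n = insert m (step2 (m + 2) n)"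
    by (auto simp: step2_def)
qed

lemma not_in_step2: "m < k \<Longrightarrow> m \<notin> step2 k n"
  by (auto simp: step2_def)

lemma prod_step2_rec:
  "m \<le> n \<Longrightarrow> (\<Prod>k \<in> step2 m n. f k) = f m * (\<Prod>k \<in> step2 (m + 2) n. f k)"
  by (simp add: step2_rec not_in_step2)

lemma sum_step2_rec:
  "m \<le> n \<Longrightarrow> (\<Sum>k \<in> step2 m n. f k) = f m + (\<Sum>k \<in> step2 (m + 2) n. f k)"
  by (simp add: step2_rec not_in_step2)

lemma square_linear_factor:
  fixes a b c x y :: real
  shows "(2 * a * x + b * y)\<^sup>2
    = 4 * a * (a * x\<^sup>2 + b * x * y + c * y\<^sup>2) - (4 * a * c - b\<^sup>2) * y\<^sup>2"
  by (simp add: power2_eq_square algebra_simps)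

lemma quadratic_form_pos:
  fixes a b c x y :: real
  assumes "a > 0" and "4 * a * c - b\<^sup>2 > 0" and "y \<noteq> 0"
  shows "a * x\<^sup>2 + b * x * y + c * y\<^sup>2 > 0"
proof -
  have "(4 * a * c - b\<^sup>2) * y\<^sup>2 > 0"
    using assms by simp
  with square_linear_factor[of a x b y c] zero_le_power2[of "2 * a * x + b * y"]
  have "4 * a * (a * x\<^sup>2 + b * x * y + c * y\<^sup>2) > 0"
    by linarith
  thus ?thesis
    using \<open>a > 0\<close> by (simp add: zero_less_mult_iff)
qed

lemma has_real_derivative_R_powi:
  assumes "a > 0" and "4 * a * c - b\<^sup>2 > 0" and "y \<noteq> 0"
  shows "((\<lambda>t. R a b c t y powi l) has_real_derivative
     of_int l / 2 * (R a b c x y powi (l - 2) * (2 * a * x + b * y))) (at x)"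
proof -
  define Q where "Q = (\<lambda>t. a * t\<^sup>2 + b * t * y + c * y\<^sup>2)"
  have Q: "Q x > 0"
    using quadratic_form_pos[OF assms] by (simp add: Q_def)
  hence R: "R a b c x y > 0"
    by (simp add: R_def Q_def)
  have "(Q has_real_derivative 2 * a * x + b * y) (at x)"
    unfolding Q_def by (auto intro!: derivative_eq_intros)
  hence "((\<lambda>t. sqrt (Q t)) has_real_derivative
      inverse (sqrt (Q x)) / 2 * (2 * a * x + b * y)) (at x)"
    using Q DERIV_real_sqrt DERIV_chain2 by blast
  hence "((\<lambda>t. R a b c t y) has_real_derivative
      inverse (R a b c x y) / 2 * (2 * a * x + b * y)) (at x)"
    by (simp add: R_def Q_def)
  from DERIV_power_int[OF this, of l] R
  have "((\<lambda>t. R a b c t y powi l) has_real_derivative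
      of_int l * R a b c x y powi (l - 1) * (inverse (R a b c x y) / 2 * (2 * a * x + b * y)))
      (at x)"
    by (simp add: mult_ac)
  moreover have "R a b c x y powi (l - 1) * inverse (R a b c x y) = R a b c x y powi (l - 2)"
    using R power_int_diff[of "R a b c x y" "l - 1" 1] by (simp add: divide_inverse)
  hence "of_int l * R a b c x y powi (l - 1) * (inverse (R a b c x y) / 2 * (2 * a * x + b * y))
      = of_int l / 2 * (R a b c x y powi (l - 2) * (2 * a * x + b * y))"
    by (simp only: divide_inverse mult_ac flip: \<open>_ = R a b c x y powi (l - 2)\<close>)
  ultimately show ?thesis
    by (simp only:)
qed

text \<open>
  The product rule produces \<open>L\<^sup>2 R\<^sup>p\<close>; replacing \<open>L\<^sup>2\<close> by means of \<open>square_linear_factor\<close> turns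
  the derivative of \<open>R\<^bsup>p+2\<^esup> L\<close> into
  \<open>2 a (p + 3) R\<^bsup>p+2\<^esup> - (p + 2) (4 a c - b\<^sup>2) y\<^sup>2 R\<^sup>p / 2\<close>, that is,
  \<open>y\<^sup>2 R\<^sup>p / E\<^sub>p - D\<^sub>p R\<^bsup>p+2\<^esup>\<close>. The case \<open>p = -2\<close> is the one in which \<open>R\<^sup>p\<close> drops out.
\<close>

lemma R_powi_reduction:
  assumes "a > 0" and "4 * a * c - b\<^sup>2 > 0" and "y \<noteq> 0" and "p \<noteq> -2"
  shows "((\<lambda>t. R a b c t y powi (p + 2) * (2 * a * t + b * y)) has_real_derivative
     y\<^sup>2 * R a b c x y powi p / E a b c p - D a p * R a b c x y powi (p + 2)) (at x)"
proof -
  define r where "r = R a b c x y"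
  define L where "L = 2 * a * x + b * y"
  define \<Delta> where "\<Delta> = 4 * a * c - b\<^sup>2"
  have pos: "a * x\<^sup>2 + b * x * y + c * y\<^sup>2 > 0"
    using quadratic_form_pos assms by blast
  hence "r > 0" and r2: "r\<^sup>2 = a * x\<^sup>2 + b * x * y + c * y\<^sup>2"
    by (auto simp: r_def R_def)
  have L2: "L * L = 4 * a * r\<^sup>2 - \<Delta> * y\<^sup>2"
    using square_linear_factor[of a x b y c]
    by (simp only: L_def \<Delta>_def r2 power2_eq_square[of "2 * a * x + b * y"])
  have r_Suc2: "r powi (p + 2) = r powi p * r\<^sup>2"
    using \<open>r > 0\<close> power_int_add[of r p 2] by simp
  have deriv: "((\<lambda>t. R a b c t y powi (p + 2) * (2 * a * t + b * y)) has_real_derivative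
      of_int (p + 2) / 2 * (r powi p * L) * L + 2 * a * r powi (p + 2)) (at x)"
    unfolding r_def L_def
    by (rule derivative_eq_intros has_real_derivative_R_powi assms refl | simp)+
  have "of_int (p + 2) / 2 * (r powi p * L) * L + 2 * a * r powi (p + 2)
      = of_int (p + 2) / 2 * r powi p * (L * L) + 2 * a * r powi (p + 2)"
    by (simp add: mult_ac)
  also have "\<dots> = - (\<Delta> * (of_int p + 2) / 2) * (y\<^sup>2 * r powi p) - D a p * r powi (p + 2)"
    unfolding L2 r_Suc2 D_def by (simp add: field_simps)
  also have "- (\<Delta> * (of_int p + 2) / 2) * (y\<^sup>2 * r powi p) = y\<^sup>2 * r powi p / E a b c p"
    by (simp add: E_def \<Delta>_def)
  finally have eq: "of_int (p + 2) / 2 * (r powi p * L) * L + 2 * a * r powi (p + 2)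
      = y\<^sup>2 * r powi p / E a b c p - D a p * r powi (p + 2)" .
  from deriv show ?thesis
    unfolding eq by (simp only: r_def)
qed

text \<open>
  In every summand but the first, the factors \<open>D\<^sub>p\<close>, \<open>E\<^sub>p\<close> and \<open>y\<^bsup>-2\<^esup>\<close> split off, and what
  remains is a summand of the closed form for \<open>p + 2\<close>. For \<open>p = -3\<close> the closed form for \<open>p + 2\<close>
  is the empty sum.
\<close>

lemma I1_0_rec:
  assumes "p \<le> -3" and "y \<noteq> 0"
  shows "I1_0 a b c p x y = E a b c p / y\<^sup>2 *
     (R a b c x y powi (p + 2) * (2 * a * x + b * y) + D a p * I1_0 a b c (p + 2) x y)"
proof -
  define T where "T = (\<lambda>q l. (\<Prod>l2 \<in> step2 q (l - 4). D a l2) *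
      (\<Prod>l2 \<in> step2 q (l - 2). E a b c l2) *
      R a b c x y powi l * (2 * a * x + b * y) * y powi (q - l))"
  have I: "I1_0 a b c q x y = (\<Sum>l \<in> step2 (q + 2) (-1). T q l)" for q
    by (simp add: I1_0_def T_def)
  have first: "T p (p + 2) = E a b c p / y\<^sup>2 * (R a b c x y powi (p + 2) * (2 * a * x + b * y))"
    by (simp add: T_def step2_empty prod_step2_rec power_int_minus divide_inverse mult_ac)
  have later: "T p l = E a b c p / y\<^sup>2 * D a p * T (p + 2) l" if "l \<in> step2 (p + 4) (-1)" for l
  proof -
    have "p \<le> l - 4"
      using that by (simp add: step2_def)
    hence "(\<Prod>l2 \<in> step2 p (l - 4). D a l2) = D a p * (\<Prod>l2 \<in> step2 (p + 2) (l - 4). D a l2)"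
      and "(\<Prod>l2 \<in> step2 p (l - 2). E a b c l2)
        = E a b c p * (\<Prod>l2 \<in> step2 (p + 2) (l - 2). E a b c l2)"
      by (auto intro!: prod_step2_rec)
    moreover have "y powi (p - l) = y powi (p + 2 - l) / y\<^sup>2"
      using power_int_diff[of y "p + 2 - l" 2] \<open>y \<noteq> 0\<close> by (simp add: algebra_simps)
    ultimately show ?thesis
      by (simp add: T_def mult_ac)
  qed
  have "I1_0 a b c p x y = T p (p + 2) + (\<Sum>l \<in> step2 (p + 4) (-1). T p l)"
    using \<open>p \<le> -3\<close> by (simp add: I sum_step2_rec add.assoc)
  also have "(\<Sum>l \<in> step2 (p + 4) (-1). T p l) = E a b c p / y\<^sup>2 * D a p * I1_0 a b c (p + 2) x y"
    by (simp add: I later sum_distrib_left add.assoc)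
  finally show ?thesis
    by (simp only: first distrib_left mult.assoc)
qed

text \<open>
  The hypothesis is weighted by \<open>D\<^sub>p\<close> so that it also covers \<open>p = -3\<close>: there \<open>I1_0\<close> at exponent
  \<open>-1\<close> is not an antiderivative of \<open>R\<^bsup>-1\<^esup>\<close>, but its coefficient \<open>D\<^sub>p\<close> is \<open>0\<close>.
\<close>

lemma has_real_derivative_I1_0_step:
  assumes "a > 0" and "4 * a * c - b\<^sup>2 > 0" and "y \<noteq> 0" and "p \<le> -3"
    and I: "((\<lambda>t. D a p * I1_0 a b c (p + 2) t y) has_real_derivative
      D a p * R a b c x y powi (p + 2)) (at x)"
  shows "((\<lambda>t. I1_0 a b c p t y) has_real_derivative R a b c x y powi p) (at x)"
proof -
  have "real_of_int p + 2 \<noteq> 0"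
    using \<open>p \<le> -3\<close> by linarith
  hence E: "E a b c p \<noteq> 0"
    using assms by (simp add: E_def)
  have "((\<lambda>t. R a b c t y powi (p + 2) * (2 * a * t + b * y)) has_real_derivative
      y\<^sup>2 * R a b c x y powi p / E a b c p - D a p * R a b c x y powi (p + 2)) (at x)"
    using assms by (intro R_powi_reduction) auto
  from DERIV_cmult[OF DERIV_add[OF this I], of "E a b c p / y\<^sup>2"]
  have "((\<lambda>t. I1_0 a b c p t y) has_real_derivative
      E a b c p / y\<^sup>2 * (y\<^sup>2 * R a b c x y powi p / E a b c p)) (at x)"
    by (simp only: I1_0_rec[OF \<open>p \<le> -3\<close> \<open>y \<noteq> 0\<close>] diff_add_cancel)
  thus ?thesis
    using E \<open>y \<noteq> 0\<close> by simp
qed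

lemma has_real_derivative_I1_0:
  assumes "a > 0" and "4 * a * c - b\<^sup>2 > 0" and "y \<noteq> 0" and "odd p" and "p \<le> -3"
  shows "((\<lambda>t. I1_0 a b c p t y) has_real_derivative R a b c x y powi p) (at x)"
proof -
  have "((\<lambda>t. I1_0 a b c (-3 - 2 * int k) t y) has_real_derivative
      R a b c x y powi (-3 - 2 * int k)) (at x)" for k
  proof (induction k)
    case 0
    have "D a (-3) = 0"
      by (simp add: D_def)
    thus ?case
      using has_real_derivative_I1_0_step[of a c b y "-3" x] assms by simp
  next
    case (Suc k)
    let ?p = "-3 - 2 * int (Suc k)"
    have "?p + 2 = -3 - 2 * int k"
      by simp
    hence "((\<lambda>t. D a ?p * I1_0 a b c (?p + 2) t y) has_real_derivative
        D a ?p * R a b c x y powi (?p + 2)) (at x)"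
      using DERIV_cmult[OF Suc.IH] by (simp only:)
    thus ?case
      by (rule has_real_derivative_I1_0_step[OF assms(1-3), rotated]) simp
  qed
  from this[of "nat ((-3 - p) div 2)"] show ?thesis
    using \<open>odd p\<close> \<open>p \<le> -3\<close> by simp
qed

lemma has_real_derivative_I1_1:
  assumes "a > 0" and "4 * a * c - b\<^sup>2 > 0" and "y \<noteq> 0" and "p \<noteq> -2"
    and I: "((\<lambda>t. I1_0 a b c p t y) has_real_derivative R a b c x y powi p) (at x)"
  shows "((\<lambda>t. I1_1 a b c p t y) has_real_derivative R a b c x y powi p * x) (at x)"
proof -
  have p: "real_of_int p + 2 \<noteq> 0"
    using \<open>p \<noteq> -2\<close> by linarith
  have "((\<lambda>t. R a b c t y powi (p + 2)) has_real_derivative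
      (of_int p + 2) / 2 * (R a b c x y powi p * (2 * a * x + b * y))) (at x)"
    using has_real_derivative_R_powi[of a c b y "p + 2" x] assms by simp
  from DERIV_diff[OF DERIV_cmult[OF this] DERIV_cmult[OF I]]
  have "((\<lambda>t. I1_1 a b c p t y) has_real_derivative
      1 / (a * (of_int p + 2)) * ((of_int p + 2) / 2 * (R a b c x y powi p * (2 * a * x + b * y)))
      - b / (2 * a) * y * R a b c x y powi p) (at x)"
    unfolding I1_1_def .
  moreover have "1 / (a * (of_int p + 2)) *
      ((of_int p + 2) / 2 * (R a b c x y powi p * (2 * a * x + b * y)))
      = R a b c x y powi p * (2 * a * x + b * y) / (2 * a)"
    using p \<open>a > 0\<close> by simp
  moreover have "R a b c x y powi p * (2 * a * x + b * y) / (2 * a)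
      - b / (2 * a) * y * R a b c x y powi p = R a b c x y powi p * x"
    using \<open>a > 0\<close> by (simp add: field_simps)
  ultimately show ?thesis
    by (simp only:)
qed

theorem lemma15:
  fixes a b c :: real and p :: int
  assumes "a > 0" and "c > 0" and "4 * a * c - b\<^sup>2 > 0"
    and "odd p" and "p \<le> -3"
  shows "\<forall>x y. y \<noteq> 0 \<longrightarrow>
    ((\<lambda>t. I1_0 a b c p t y) has_real_derivative R a b c x y powi p) (at x) \<and>
    ((\<lambda>t. I1_1 a b c p t y) has_real_derivative R a b c x y powi p * x) (at x)"
proof (intro allI impI conjI)
  fix x y :: real
  assume "y \<noteq> 0"
  thus I: "((\<lambda>t. I1_0 a b c p t y) has_real_derivative R a b c x y powi p) (at x)"
    using has_real_derivative_I1_0 assms by blast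
  show "((\<lambda>t. I1_1 a b c p t y) has_real_derivative R a b c x y powi p * x) (at x)"
    using has_real_derivative_I1_1[OF _ _ _ _ I] assms \<open>y \<noteq> 0\<close> by simp
qed

end
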